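(* Let $G=(S,T;E)$ be a bipartite graph with $|S|=n$, $w:E\to\mathbb R_+$, $d\in\mathbb N$ and $b:S\cup T\to\mathbb Z_+\cup\{\infty\}$. Consider the following randomized algorithm (Algorithm 1): define $b'(v)=b(v)$ for $v\in S$ and $b'(t)=\min\{\lfloor n/d\rfloor,b(t)\}$ for $t\in T$; find a maximum-weight $b'$-matching $\widehat M$ of $G$ (an edge set in which every $v$ has degree at most $b'(v)$); generate a cyclic permutation $s_1,\dots,s_n$ of $S$ uniformly at random; let $M$ consist of all edges $s_it\in\widehat M$ ($t\in T$, $i\in\{1,\dots,n\}$) such that none of $s_{i-d+1}t,\dots,s_{i-1}t$ (indices modulo $n$) belongs to $\widehat M$; output $s_1,\dots,s_n$ and $M$. Then $M$ is a cyclic $d$-distance $b$-matching under the ordering $s_1,\dots,s_n$, and its expected weight is at least \[ \max\left\{\left(1-\frac1d\right)^{d-1},\ \left(1-\frac1k\right)^{k-1}\right\} \] times the maximum, over all cyclic orderings of $S$, of the weight of a heaviest cyclic $d$-distance $b$-matching under that ordering, where $k=\max_{t\in T}b'(t)$. This lower bound is tight.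
   Context: For an ordering $s_1,\dots,s_n$ of $S$, an edge set $M\subseteq E$ is a cyclic $d$-distance $b$-matching if every $v\in S\cup T$ has degree at most $b(v)$ in $M$ and whenever $s_it,s_jt\in M$ with $i\ne j$, both $|i-j|\ge d$ and $|i-j|\le n-d$. The weight of $M$ is $w(M)=\sum_{e\in M}w(e)$.
   Formalization: The expected-weight bound is stated for 1 ≤ d ≤ n (for d > n it fails: b'(t)=0 makes M empty though a single edge is feasible); "tight" means the bound is approached for each fixed d as k grows and for each fixed k as d grows. *)

theory Defs
  imports
    "HOL-Probability.Probability_Mass_Function"
    "HOL-Combinatorics.Multiset_Permutations"
    "HOL-Library.Extended_Nat"
begin

(* Edges of a bipartite graph (S,T;E) are pairs whose first component lies in S. *)
definition bipartite_graph :: "'v set \<Rightarrow> 'v set \<Rightarrow> ('v \<times> 'v) set \<Rightarrow> bool" where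
  "bipartite_graph S T E \<longleftrightarrow> finite S \<and> finite T \<and> S \<inter> T = {} \<and> E \<subseteq> S \<times> T"

definition degree :: "('v \<times> 'v) set \<Rightarrow> 'v \<Rightarrow> nat" where
  "degree M v = card {e \<in> M. fst e = v \<or> snd e = v}"

definition weight :: "('v \<times> 'v \<Rightarrow> real) \<Rightarrow> ('v \<times> 'v) set \<Rightarrow> real" where
  "weight w M = (\<Sum>e\<in>M. w e)"

definition b_matching ::
  "'v set \<Rightarrow> 'v set \<Rightarrow> ('v \<times> 'v) set \<Rightarrow> ('v \<Rightarrow> enat) \<Rightarrow> ('v \<times> 'v) set \<Rightarrow> bool" where
  "b_matching S T E b M \<longleftrightarrow> M \<subseteq> E \<and> (\<forall>v\<in>S \<union> T. enat (degree M v) \<le> b v)"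

definition max_weight_b_matching ::
  "'v set \<Rightarrow> 'v set \<Rightarrow> ('v \<times> 'v) set \<Rightarrow> ('v \<times> 'v \<Rightarrow> real) \<Rightarrow> ('v \<Rightarrow> enat) \<Rightarrow> ('v \<times> 'v) set \<Rightarrow> bool"
  where
  "max_weight_b_matching S T E w b M \<longleftrightarrow>
     b_matching S T E b M \<and> (\<forall>M'. b_matching S T E b M' \<longrightarrow> weight w M' \<le> weight w M)"

(* An ordering of S is a list in permutations_of_set S; positions are counted from 0 instead
   of 1, which changes no difference of positions. *)
definition cyclic_distance_b_matching ::
  "'v set \<Rightarrow> 'v set \<Rightarrow> ('v \<times> 'v) set \<Rightarrow> nat \<Rightarrow> ('v \<Rightarrow> enat) \<Rightarrow> 'v list \<Rightarrow> ('v \<times> 'v) set \<Rightarrow> bool"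
  where
  "cyclic_distance_b_matching S T E d b s M \<longleftrightarrow>
     b_matching S T E b M \<and>
     (\<forall>t\<in>T. \<forall>i<length s. \<forall>j<length s. i \<noteq> j \<and> (s ! i, t) \<in> M \<and> (s ! j, t) \<in> M \<longrightarrow>
        \<bar>int i - int j\<bar> \<ge> int d \<and> \<bar>int i - int j\<bar> \<le> int (length s) - int d)"

definition heaviest_weight ::
  "'v set \<Rightarrow> 'v set \<Rightarrow> ('v \<times> 'v) set \<Rightarrow> ('v \<times> 'v \<Rightarrow> real) \<Rightarrow> nat \<Rightarrow> ('v \<Rightarrow> enat) \<Rightarrow> 'v list \<Rightarrow> real"
  where
  "heaviest_weight S T E w d b s =
     Max (weight w ` {M. cyclic_distance_b_matching S T E d b s M})"

definition opt_weight ::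
  "'v set \<Rightarrow> 'v set \<Rightarrow> ('v \<times> 'v) set \<Rightarrow> ('v \<times> 'v \<Rightarrow> real) \<Rightarrow> nat \<Rightarrow> ('v \<Rightarrow> enat) \<Rightarrow> real"
  where
  "opt_weight S T E w d b = Max (heaviest_weight S T E w d b ` permutations_of_set S)"

definition capped :: "'v set \<Rightarrow> 'v set \<Rightarrow> nat \<Rightarrow> ('v \<Rightarrow> enat) \<Rightarrow> 'v \<Rightarrow> enat" where
  "capped S T d b v = (if v \<in> T then min (enat (card S div d)) (b v) else b v)"

(* capped is finite on T, so the_enat loses nothing when T is nonempty. *)
definition max_cap :: "'v set \<Rightarrow> 'v set \<Rightarrow> nat \<Rightarrow> ('v \<Rightarrow> enat) \<Rightarrow> nat" where
  "max_cap S T d b = the_enat (Max (capped S T d b ` T))"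

(* The modulus is taken on int, where the index i - j does not truncate at 0. *)
definition select_edges :: "'v set \<Rightarrow> nat \<Rightarrow> ('v \<times> 'v) set \<Rightarrow> 'v list \<Rightarrow> ('v \<times> 'v) set" where
  "select_edges T d Mhat s =
     {(s ! i, t) | i t. i < length s \<and> t \<in> T \<and> (s ! i, t) \<in> Mhat \<and>
        (\<forall>j\<in>{1..<d}. (s ! nat ((int i - int j) mod int (length s)), t) \<notin> Mhat)}"

(* The distribution of the output (ordering, M) for a given choice of the maximum-weight
   matching Mhat. Rotating s does not change the selected edges, so a uniform ordering
   represents a uniform cyclic arrangement of S. *)
definition algorithm_output ::
  "'v set \<Rightarrow> 'v set \<Rightarrow> nat \<Rightarrow> ('v \<times> 'v) set \<Rightarrow> ('v list \<times> ('v \<times> 'v) set) pmf" where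
  "algorithm_output S T d Mhat =
     map_pmf (\<lambda>s. (s, select_edges T d Mhat s)) (pmf_of_set (permutations_of_set S))"

definition expected_weight ::
  "'v set \<Rightarrow> 'v set \<Rightarrow> ('v \<times> 'v \<Rightarrow> real) \<Rightarrow> nat \<Rightarrow> ('v \<times> 'v) set \<Rightarrow> real" where
  "expected_weight S T w d Mhat =
     measure_pmf.expectation (algorithm_output S T d Mhat) (\<lambda>(s, M). weight w M)"

definition ratio_bound :: "nat \<Rightarrow> nat \<Rightarrow> real" where
  "ratio_bound d k = max ((1 - 1 / real d) ^ (d - 1)) ((1 - 1 / real k) ^ (k - 1))"

(* There is an instance with parameters d and k on which the expected weight stays below c times
   the optimum, whichever maximum-weight matching is used in the first step. *)
definition bad_instance :: "nat \<Rightarrow> nat \<Rightarrow> real \<Rightarrow> bool" where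
  "bad_instance d k c \<longleftrightarrow>
     (\<exists>(S :: nat set) T E w b.
        bipartite_graph S T E \<and> (\<forall>e\<in>E. 0 \<le> w e) \<and> T \<noteq> {} \<and> d \<le> card S \<and> max_cap S T d b = k \<and>
        0 < opt_weight S T E w d b \<and>
        (\<forall>Mhat. max_weight_b_matching S T E w (capped S T d b) Mhat \<longrightarrow>
           expected_weight S T w d Mhat < c * opt_weight S T E w d b))"

end

theory Submission imports Defs begin

text \<open>If \<open>t\<close> has degree \<open>a\<close> in the chosen matching, an edge \<open>xt\<close> survives exactly when the \<open>d - 1\<close>
  cyclic predecessors of \<open>x\<close> avoid the \<open>a\<close> neighbours of \<open>t\<close>, an event of probability
  \<open>C(n - a, d - 1) / C(n - 1, d - 1) = C(n - d, a - 1) / C(n - 1, a - 1)\<close>. Since \<open>d * a \<le> n\<close>, every factor of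
  the first product form is at least \<open>1 - 1 / d\<close> and every factor of the second at least \<open>1 - 1 / a\<close>,
  and \<open>(1 - 1 / a)^(a - 1)\<close> decreases in \<open>a\<close>. A cyclic \<open>d\<close>-distance matching has degree at most
  \<open>n div d\<close> on the right, so its weight is bounded by that of the chosen matching. For \<open>n = d * a\<close> both
  products tend to their bounds as \<open>a\<close> or \<open>d\<close> grows, which gives tightness.\<close>

section \<open>Counting orderings whose prefix avoids a set\<close>

text \<open>Fill the positions from the front: the \<open>p\<close> entries before \<open>x\<close>
  are distinct members of \<open>S - A\<close>, and the entries after \<open>x\<close> are free.
  When \<open>S - A\<close> is too small, truncated subtraction makes a factor vanish.\<close>

lemma card_permutations_avoiding_prefix:
  assumes "finite S" "A \<subseteq> S" "x \<in> A" "p < card S"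
  shows "card {s \<in> permutations_of_set S. s ! p = x \<and> (\<forall>q<p. s ! q \<notin> A)}
           = (\<Prod>j<p. card S - card A - j) * fact (card S - 1 - p)"
  using assms
proof (induction p arbitrary: S)
  case 0
  then have "S \<noteq> {}" by auto
  then have "{s \<in> permutations_of_set S. s ! 0 = x \<and> (\<forall>q<0. s ! q \<notin> A)}
      = (#) x ` permutations_of_set (S - {x})"
    using 0 by (auto simp: permutations_of_set_nonempty)
  with 0 show ?case
    by (simp add: card_image subset_iff)
next
  case (Suc p)
  let ?R = "\<lambda>S p. {s \<in> permutations_of_set S. s ! p = x \<and> (\<forall>q<p. s ! q \<notin> A)}"
  have "S \<noteq> {}" using Suc.prems by auto
  \<comment> \<open>The head \<open>y\<close> lies outside \<open>A\<close>, so \<open>A\<close>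
    stays inside \<open>S - {y}\<close> and the induction hypothesis applies to the tail.\<close>
  then have eq: "?R S (Suc p) = (\<Union>y\<in>S - A. (#) y ` ?R (S - {y}) p)"
    by (auto simp: permutations_of_set_nonempty nth_Cons All_less_Suc2 image_iff)
  have fin: "finite (?R (S - {y}) p)" for y
    using Suc.prems by (auto intro: finite_subset[OF _ finite_permutations_of_set])
  have "card (?R S (Suc p)) = (\<Sum>y\<in>S - A. card ((#) y ` ?R (S - {y}) p))"
    unfolding eq using Suc.prems fin by (intro card_UN_disjoint) auto
  also have "\<dots> = (\<Sum>y\<in>S - A. (\<Prod>j<p. card S - 1 - card A - j) * fact (card S - 1 - 1 - p))"
  proof (rule sum.cong)
    fix y assume y: "y \<in> S - A"
    have "card (?R (S - {y}) p)
        = (\<Prod>j<p. card (S - {y}) - card A - j) * fact (card (S - {y}) - 1 - p)"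
      using Suc.prems y by (intro Suc.IH) auto
    then show "card ((#) y ` ?R (S - {y}) p)
        = (\<Prod>j<p. card S - 1 - card A - j) * fact (card S - 1 - 1 - p)"
      using Suc.prems y by (simp add: card_image)
  qed simp
  \<comment> \<open>The \<open>card S - card A\<close> choices of \<open>y\<close> supply the factor
    for \<open>j = 0\<close>; the remaining factors are shifted by one.\<close>
  also have "\<dots> = (\<Prod>j<Suc p. card S - card A - j) * fact (card S - 1 - Suc p)"
    using Suc.prems by (simp add: prod.lessThan_Suc_shift card_Diff_subset finite_subset
        diff_diff_left add.commute del: prod.lessThan_Suc)
  finally show ?case .
qed

lemma rotate_permutations_of_set_iff:
  "rotate r s \<in> permutations_of_set S \<longleftrightarrow> s \<in> permutations_of_set S"
  by (simp add: permutations_of_set_def)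

text \<open>Rotation permutes the orderings, so an event may be moved to a convenient position
  without changing its count.\<close>

lemma card_permutations_rotate:
  "card {s \<in> permutations_of_set S. P (rotate r s)} = card {s \<in> permutations_of_set S. P s}"
proof -
  let ?Q = "{s \<in> permutations_of_set S. P s}"
  have bij: "bij (rotate r :: 'a list \<Rightarrow> 'a list)"
    unfolding rotate_def by (rule bij_fn[OF bij_rotate1])
  have "card ?Q = card (rotate r -` ?Q)"
    using bij by (intro card_vimage_inj[symmetric]) (auto simp: bij_is_inj bij_is_surj)
  also have "rotate r -` ?Q = {s \<in> permutations_of_set S. P (rotate r s)}"
    by (auto simp: rotate_permutations_of_set_iff)
  finally show ?thesis by simp
qed

section \<open>Survival probability: symmetry, lower bounds and limit\<close>

text \<open>The probability that the \<open>d - 1\<close> cyclic predecessors of a member of an \<open>a\<close>-element set avoid that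
  set, in a random cyclic arrangement of \<open>n\<close> elements.\<close>

definition avoid_prob :: "nat \<Rightarrow> nat \<Rightarrow> nat \<Rightarrow> real" where
  "avoid_prob n a d = (\<Prod>j<d - 1. (real n - real a - real j) / (real n - 1 - real j))"

lemma prod_falling_fact:
  "m \<le> N \<Longrightarrow> (\<Prod>j<m. real N - real j) = fact N / fact (N - m)"
proof (induction m)
  case (Suc m)
  then have "N - m = Suc (N - Suc m)" by simp
  then have "(fact (N - m) :: real) = real (N - m) * fact (N - Suc m)"
    by (metis fact_Suc of_nat_fact of_nat_mult)
  with Suc show ?case by (simp add: field_simps of_nat_diff)
qed simp

text \<open>Numerator and denominator are falling factorials of length \<open>d - 1\<close>,
  starting at \<open>n - a\<close> and \<open>n - 1\<close>. The quotient is symmetric in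
  \<open>a\<close> and \<open>d\<close>, which yields the second product form.\<close>

lemma avoid_prob_eq_fact:
  assumes "1 \<le> a" "1 \<le> d" "a + d \<le> n + 1"
  shows "avoid_prob n a d = fact (n - a) * fact (n - d) / (fact (n - 1) * fact (n + 1 - a - d))"
proof -
  have "(\<Prod>j<d - 1. real n - real a - real j) = fact (n - a) / fact (n + 1 - a - d)"
    using prod_falling_fact[of "d - 1" "n - a"] assms by (simp add: of_nat_diff)
  moreover have "(\<Prod>j<d - 1. real n - 1 - real j) = fact (n - 1) / fact (n - d)"
    using prod_falling_fact[of "d - 1" "n - 1"] assms by (simp add: of_nat_diff)
  ultimately show ?thesis
    unfolding avoid_prob_def prod_dividef by simp
qed

lemma avoid_prob_commute:
  assumes "1 \<le> a" "1 \<le> d" "a + d \<le> n + 1"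
  shows "avoid_prob n a d = avoid_prob n d a"
  using assms by (simp add: avoid_prob_eq_fact mult.commute add.commute diff_diff_left)

lemma avoid_prob_ge:
  assumes "1 \<le> a" "1 \<le> d" "d * a \<le> n"
  shows "(1 - 1 / real d) ^ (d - 1) \<le> avoid_prob n a d"
proof -
  have da: "real d * real a \<le> real n" and "d \<le> n"
    using assms by (metis of_nat_le_iff of_nat_mult) (use assms in \<open>metis le_trans mult_le_mono2 mult.right_neutral\<close>)
  have "(\<Prod>j<d - 1. 1 - 1 / real d) \<le> avoid_prob n a d"
    unfolding avoid_prob_def
  proof (rule prod_mono, intro conjI)
    fix j assume "j \<in> {..<d - 1}"
    then have j: "real j + 2 \<le> real d" by auto
    then have pos: "0 < real n - 1 - real j" using \<open>d \<le> n\<close> by linarith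
    \<comment> \<open>The right side exceeds the left by
      \<open>(n - d * a) + (d - 1 - j)\<close>.\<close>
    have "(real d - 1) * (real n - 1 - real j) \<le> real d * (real n - real a - real j)"
      using da j by (simp add: algebra_simps)
    then show "1 - 1 / real d \<le> (real n - real a - real j) / (real n - 1 - real j)"
      using pos assms(2) by (simp add: field_simps)
    show "0 \<le> 1 - 1 / real d" using assms(2) by simp
  qed
  then show ?thesis by simp
qed

text \<open>Since \<open>1 - 1 / (m + 1)\<close> is the reciprocal of \<open>1 + 1 / m\<close>, the
  claim amounts to the monotonicity of \<open>(1 + 1 / m) ^ m\<close>. The step from
  \<open>m\<close> to \<open>m + 1\<close> is Bernoulli's inequality for
  \<open>(1 - 1 / m^2) ^ (m - 1)\<close>.\<close>

lemma decreasing_power_bound: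
  assumes "1 \<le> a" "a \<le> k"
  shows "(1 - 1 / real k) ^ (k - 1) \<le> (1 - 1 / real a) ^ (a - 1)"
  using assms(2)
proof (induction k rule: dec_induct)
  case (step m)
  have m: "1 \<le> m" using step assms by simp
  show ?case
  \<comment> \<open>For \<open>m = 1\<close> the induction hypothesis contains
    \<open>0 ^ 0 = 1\<close>, which already suffices.\<close>
  proof (cases "m = 1")
    case False
    define M where "M = real m"
    have M: "M > 1" using m False by (simp add: M_def)
    have "1 \<le> M * M" using mult_mono[of 1 M 1 M] M by simp
    then have "1 + real (m - 1) * (- 1 / M^2) \<le> (1 + (- 1 / M^2)) ^ (m - 1)"
      using M by (intro Bernoulli_inequality) (simp add: field_simps power2_eq_square)
    also have "1 + (- 1 / M^2) = (1 - 1 / M) * (1 + 1 / M)"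
      using M by (simp add: field_simps power2_eq_square)
    finally have "(1 + real (m - 1) * (- 1 / M^2)) * (1 + 1 / M)
        \<le> ((1 - 1 / M) * (1 + 1 / M)) ^ (m - 1) * (1 + 1 / M)"
      using M by (intro mult_right_mono) auto
    \<comment> \<open>The product on the right equals \<open>1 + 1 / M^3\<close>.\<close>
    moreover have "1 \<le> (1 + real (m - 1) * (- 1 / M^2)) * (1 + 1 / M)"
      using M m by (simp add: M_def of_nat_diff field_simps power2_eq_square)
    moreover have "((1 - 1 / M) * (1 + 1 / M)) ^ (m - 1) * (1 + 1 / M)
        = (1 - 1 / M) ^ (m - 1) * (1 + 1 / M) ^ m"
      using m by (cases m) (simp_all add: power_mult_distrib)
    ultimately have "1 \<le> (1 - 1 / M) ^ (m - 1) * (1 + 1 / M) ^ m" by linarith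
    then have "1 / (1 + 1 / M) ^ m \<le> (1 - 1 / M) ^ (m - 1)"
      using M by (subst pos_divide_le_eq) (auto intro!: zero_less_power add_pos_pos)
    moreover have "1 / (1 + 1 / M) ^ m = (1 - 1 / real (Suc m)) ^ m"
    proof -
      have "1 / (1 + 1 / M) = 1 - 1 / real (Suc m)"
        using M by (simp add: M_def field_simps)
      then show ?thesis by (simp flip: power_one_over)
    qed
    ultimately show ?thesis using step.IH by (simp add: M_def)
  qed (use step.IH in simp)
qed simp

text \<open>Each entry of the maximum comes from the factorwise bound, once for the product of
  \<open>d - 1\<close> factors and once, by symmetry, for the product of \<open>a - 1\<close>
  factors; monotonicity then replaces \<open>a\<close> by \<open>k\<close>.\<close>

lemma ratio_bound_le_avoid_prob:
  assumes "1 \<le> d" "1 \<le> a" "a \<le> k" "d * a \<le> n"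
  shows "ratio_bound d k \<le> avoid_prob n a d"
proof -
  obtain a' d' where "a = Suc a'" "d = Suc d'"
    using assms by (cases a; cases d) auto
  then have "a + d \<le> d * a + 1" by simp
  then have "avoid_prob n a d = avoid_prob n d a"
    using assms by (intro avoid_prob_commute) auto
  then have "(1 - 1 / real a) ^ (a - 1) \<le> avoid_prob n a d"
    using avoid_prob_ge[of d a n] assms by (simp add: mult.commute)
  then show ?thesis
    using avoid_prob_ge[of a d n] decreasing_power_bound[of a k] assms
    by (auto simp: ratio_bound_def)
qed

text \<open>The number of factors is fixed while \<open>k\<close> grows, so the limit may be taken
  factor by factor.\<close>

lemma avoid_prob_tendsto:
  assumes "1 \<le> d"
  shows "((\<lambda>k. avoid_prob (d * k) k d) \<longlongrightarrow> (1 - 1 / real d) ^ (d - 1)) at_top"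
proof -
  have "((\<lambda>k. (real (d * k) - real k - real j) / (real (d * k) - 1 - real j)) \<longlongrightarrow> 1 - 1 / real d) at_top" for j
  proof -
    have inv: "((\<lambda>k. c / real k) \<longlongrightarrow> 0) at_top" for c :: real
      by (rule lim_const_over_n)
    have "((\<lambda>k. (real d - 1 - real j / real k) / (real d - (1 + real j) / real k))
        \<longlongrightarrow> (real d - 1 - 0) / (real d - 0)) at_top"
      using assms by (intro tendsto_intros inv) auto
    moreover have "\<forall>\<^sub>F k in at_top. (real d - 1 - real j / real k) / (real d - (1 + real j) / real k)
        = (real (d * k) - real k - real j) / (real (d * k) - 1 - real j)"
      using eventually_gt_at_top[of 0]
    proof eventually_elim
      case (elim k)
      have "(real (d * k) - real k - real j) / (real (d * k) - 1 - real j)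
          = (real k * (real d - 1 - real j / real k)) / (real k * (real d - (1 + real j) / real k))"
        using elim by (simp add: right_diff_distrib mult.commute)
      then show ?case using elim by simp
    qed
    moreover have "(real d - 1 - 0) / (real d - 0) = 1 - 1 / real d"
      using assms by (simp add: field_simps)
    ultimately show ?thesis by (simp add: Lim_transform_eventually)
  qed
  then have "((\<lambda>k. avoid_prob (d * k) k d) \<longlongrightarrow> (\<Prod>j<d - 1. 1 - 1 / real d)) at_top"
    unfolding avoid_prob_def by (intro tendsto_prod)
  then show ?thesis by simp
qed

section \<open>Counting orderings in which an edge survives\<close>

lemma cyclic_predecessor_index:
  assumes "j \<le> n"
  shows "nat ((int i - int j) mod int n) = (i + n - j) mod n"
proof -
  have "int (i + n - j) = int i - int j + int n" using assms by simp
  then have "(int i - int j) mod int n = int ((i + n - j) mod n)"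
    by (simp add: zmod_int)
  then show ?thesis by simp
qed

text \<open>This is \<open>(d - 1) * (a - 1) \<ge> 0\<close> multiplied out; it supplies the side
  condition of the factorial form.\<close>

lemma add_le_Suc_if_mult_le:
  fixes a d n :: nat
  assumes "1 \<le> a" "1 \<le> d" "d * a \<le> n"
  shows "a + d \<le> n + 1"
proof -
  obtain a' d' where "a = Suc a'" "d = Suc d'"
    using assms by (cases a; cases d) auto
  then show ?thesis using assms(3) by simp
qed

text \<open>Split by the position \<open>i\<close> of \<open>x\<close>. A rotation brings
  \<open>x\<close> to position \<open>d - 1\<close>, where its predecessors fill the prefix without
  wrapping around, so every \<open>i\<close> contributes the same prefix count.\<close>

lemma card_permutations_avoiding_predecessors:
  assumes "finite S" "A \<subseteq> S" "x \<in> A" "1 \<le> d" "card A + d \<le> card S + 1"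
  shows "real (card {s \<in> permutations_of_set S. \<exists>i<length s. s ! i = x \<and>
             (\<forall>j\<in>{1..<d}. s ! nat ((int i - int j) mod int (length s)) \<notin> A)})
           = fact (card S) * avoid_prob (card S) (card A) d"
proof -
  define n a where "n = card S" and "a = card A"
  have a: "1 \<le> a" using assms by (auto simp: a_def card_gt_0_iff Suc_le_eq intro: finite_subset)
  have d: "1 \<le> d" "a + d \<le> n + 1" "d \<le> n" using assms a by (auto simp: n_def a_def)
  have len: "length s = n" if "s \<in> permutations_of_set S" for s
    using that by (simp add: n_def length_finite_permutations_of_set)
  define G where "G i = {s \<in> permutations_of_set S. s ! i = x \<and>
      (\<forall>j\<in>{1..<d}. s ! nat ((int i - int j) mod int n) \<notin> A)}" for i
  define R where "R s \<longleftrightarrow> s ! (d - 1) = x \<and> (\<forall>q<d - 1. s ! q \<notin> A)" for s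
  have "card (G i) = card {s \<in> permutations_of_set S. R s}" if i: "i < n" for i
  proof -
    \<comment> \<open>Index \<open>d - 1\<close> of the rotated list is index \<open>i\<close> of
      \<open>s\<close>; adding \<open>n\<close> keeps the subtraction from truncating.\<close>
    define r where "r = i + n - (d - 1)"
    have "R (rotate r s) \<longleftrightarrow> s ! i = x \<and>
        (\<forall>j\<in>{1..<d}. s ! nat ((int i - int j) mod int n) \<notin> A)"
      if s: "s \<in> permutations_of_set S" for s
    proof -
      have nth: "rotate r s ! q = s ! ((i + n - (d - 1 - q)) mod n)" if "q < d" for q
      proof -
        have "rotate r s ! q = s ! ((r + q) mod n)"
          using that d len[OF s] by (subst nth_rotate) auto
        also have "r + q = i + n - (d - 1 - q)" using that d by (simp add: r_def)
        finally show ?thesis .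
      qed
      have "(\<forall>q<d - 1. rotate r s ! q \<notin> A) \<longleftrightarrow>
          (\<forall>q<d - 1. s ! ((i + n - (d - 1 - q)) mod n) \<notin> A)"
        using nth by auto
      \<comment> \<open>Reindexing by \<open>j = d - 1 - q\<close> turns prefix positions into
        distances back from \<open>x\<close>.\<close>
      also have "\<dots> \<longleftrightarrow> (\<forall>j\<in>{1..<d}. s ! ((i + n - j) mod n) \<notin> A)"
      proof safe
        fix j assume *: "\<forall>q<d - 1. s ! ((i + n - (d - 1 - q)) mod n) \<notin> A"
          and j: "j \<in> {1..<d}" and in_A: "s ! ((i + n - j) mod n) \<in> A"
        have "d - 1 - (d - 1 - j) = j" "d - 1 - j < d - 1" using j by auto
        with * in_A show False by metis
      next
        fix q assume *: "\<forall>j\<in>{1..<d}. s ! ((i + n - j) mod n) \<notin> A"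
          and "q < d - 1" and "s ! ((i + n - (d - 1 - q)) mod n) \<in> A"
        moreover have "d - 1 - q \<in> {1..<d}" using \<open>q < d - 1\<close> by auto
        ultimately show False by blast
      qed
      also have "\<dots> \<longleftrightarrow> (\<forall>j\<in>{1..<d}. s ! nat ((int i - int j) mod int n) \<notin> A)"
        using d by (intro ball_cong refl) (simp add: cyclic_predecessor_index)
      finally show ?thesis
        using nth[of "d - 1"] d i by (simp add: R_def)
    qed
    then have "G i = {s \<in> permutations_of_set S. R (rotate r s)}"
      by (auto simp: G_def)
    then show ?thesis by (simp add: card_permutations_rotate)
  qed
  moreover have "card {s \<in> permutations_of_set S. R s}
      = (\<Prod>j<d - 1. n - a - j) * fact (n - 1 - (d - 1))"
    unfolding R_def n_def a_def
    using assms d by (intro card_permutations_avoiding_prefix) (auto simp: n_def)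
  \<comment> \<open>The events are disjoint because \<open>x\<close> has only one position in a
    distinct list.\<close>
  moreover have "card (\<Union>i\<in>{..<n}. G i) = (\<Sum>i<n. card (G i))"
  proof (intro card_UN_disjoint ballI impI)
    show "finite (G i)" for i
      by (auto simp: G_def intro: finite_subset[OF _ finite_permutations_of_set])
    fix i j assume "i \<in> {..<n}" "j \<in> {..<n}" "i \<noteq> j"
    then show "G i \<inter> G j = {}"
      by (auto simp: G_def len nth_eq_iff_index_eq dest: permutations_of_setD)
  qed simp
  moreover have "(\<Union>i\<in>{..<n}. G i) = {s \<in> permutations_of_set S. \<exists>i<length s. s ! i = x \<and>
      (\<forall>j\<in>{1..<d}. s ! nat ((int i - int j) mod int (length s)) \<notin> A)}" (is "_ = ?L")
    by (auto simp: G_def len)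
  ultimately have "card ?L = n * ((\<Prod>j<d - 1. n - a - j) * fact (n - 1 - (d - 1)))"
    by simp
  moreover have "n - 1 - (d - 1) = n - d" using d by simp
  \<comment> \<open>No truncation occurs, because \<open>j < d - 1 \<le> n - a\<close>.\<close>
  moreover have "real (\<Prod>j<d - 1. n - a - j) = (\<Prod>j<d - 1. real (n - a) - real j)"
    unfolding of_nat_prod using d by (intro prod.cong) auto
  ultimately have "real (card ?L) = real n * (fact (n - a) / fact (n + 1 - a - d) * fact (n - d))"
    using prod_falling_fact[of "d - 1" "n - a"] d a by simp
  also have "\<dots> = fact n * avoid_prob n a d"
  proof -
    have "(fact n :: real) = real n * fact (n - 1)"
      using d by (intro fact_reduce) auto
    then show ?thesis using avoid_prob_eq_fact[of a d n] d a by simp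
  qed
  finally show ?thesis unfolding n_def a_def .
qed

section \<open>Expected weight as a sum over edges\<close>

lemma finite_edges:
  assumes "bipartite_graph S T E" "M \<subseteq> E"
  shows "finite M"
proof (rule finite_subset)
  show "M \<subseteq> S \<times> T" using assms by (auto simp: bipartite_graph_def)
  show "finite (S \<times> T)" using assms by (simp add: bipartite_graph_def)
qed

text \<open>Disjointness of \<open>S\<close> and \<open>T\<close> keeps \<open>t\<close> from being
  a first component, so only left neighbours count.\<close>

lemma degree_right:
  assumes "bipartite_graph S T E" "M \<subseteq> E" "t \<in> T"
  shows "degree M t = card {y. (y, t) \<in> M}"
proof -
  have "{e \<in> M. fst e = t \<or> snd e = t} = (\<lambda>y. (y, t)) ` {y. (y, t) \<in> M}"
    using assms by (force simp: bipartite_graph_def)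
  then show ?thesis by (simp add: degree_def card_image inj_on_def)
qed

lemma mem_select_edges_iff:
  "(x, t) \<in> select_edges T d M s \<longleftrightarrow> t \<in> T \<and> (x, t) \<in> M \<and> (\<exists>i<length s. s ! i = x \<and>
     (\<forall>j\<in>{1..<d}. s ! nat ((int i - int j) mod int (length s)) \<notin> {y. (y, t) \<in> M}))"
  by (auto simp: select_edges_def)

lemma select_edges_subset: "select_edges T d M s \<subseteq> M"
  by (auto simp: select_edges_def)

text \<open>Linearity of expectation: each edge contributes its weight times its survival
  probability, which depends only on the degree of its right end.\<close>

lemma expected_weight_eq:
  assumes G: "bipartite_graph S T E" and "M \<subseteq> E" "1 \<le> d"
    and deg: "\<And>t. t \<in> T \<Longrightarrow> d * card {y. (y, t) \<in> M} \<le> card S"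
  shows "expected_weight S T w d M
           = (\<Sum>(x, t)\<in>M. w (x, t) * avoid_prob (card S) (card {y. (y, t) \<in> M}) d)"
proof -
  let ?P = "permutations_of_set S"
  have fin: "finite S" "finite M"
    using G finite_edges[OF assms(1,2)] by (simp_all add: bipartite_graph_def)
  have "expected_weight S T w d M = (\<Sum>s\<in>?P. weight w (select_edges T d M s)) / fact (card S)"
    using fin by (simp add: expected_weight_def algorithm_output_def integral_pmf_of_set)
  \<comment> \<open>Summing indicators over the fixed set \<open>M\<close> lets the sums over
    orderings and edges be exchanged.\<close>
  also have "(\<Sum>s\<in>?P. weight w (select_edges T d M s))
      = (\<Sum>s\<in>?P. \<Sum>e\<in>M. if e \<in> select_edges T d M s then w e else 0)"
    by (simp only: weight_def Int_absorb1[OF select_edges_subset]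
        flip: sum.inter_restrict[OF fin(2)])
  also have "\<dots> = (\<Sum>e\<in>M. \<Sum>s\<in>?P. if e \<in> select_edges T d M s then w e else 0)"
    by (rule sum.swap)
  also have "\<dots> = (\<Sum>e\<in>M. w e * card {s \<in> ?P. e \<in> select_edges T d M s})"
    by (simp only: sum.inter_filter[OF finite_permutations_of_set, symmetric] sum_constant mult.commute)
  also have "\<dots> = (\<Sum>(x, t)\<in>M. w (x, t) *
      (fact (card S) * avoid_prob (card S) (card {y. (y, t) \<in> M}) d))"
  proof (rule sum.cong, safe)
    fix x t assume e: "(x, t) \<in> M"
    let ?A = "{y. (y, t) \<in> M}"
    have t: "t \<in> T" and A: "?A \<subseteq> S" using e assms by (auto simp: bipartite_graph_def)
    then have "1 \<le> card ?A"
      using e fin by (auto simp: Suc_le_eq card_gt_0_iff intro: finite_subset)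
    then have "card ?A + d \<le> card S + 1"
      using deg[OF t] assms by (intro add_le_Suc_if_mult_le) auto
    then show "w (x, t) * card {s \<in> ?P. (x, t) \<in> select_edges T d M s}
        = w (x, t) * (fact (card S) * avoid_prob (card S) (card ?A) d)"
      using card_permutations_avoiding_predecessors[of S ?A x d] A e t fin assms(3)
      by (simp add: mem_select_edges_iff)
  qed
  finally show ?thesis
    by (simp only: sum_divide_distrib case_prod_unfold) simp
qed

section \<open>Degree caps for matchings\<close>

text \<open>The arcs of \<open>d\<close> consecutive residues starting at the members of
  \<open>I\<close> are pairwise disjoint in a cycle of length \<open>n\<close>.\<close>

lemma cyclic_spread_card:
  fixes I :: "nat set"
  assumes "I \<subseteq> {..<n}" "d \<le> n"
    and spread: "\<And>i j. i \<in> I \<Longrightarrow> j \<in> I \<Longrightarrow> i \<noteq> j \<Longrightarrow>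
      int d \<le> \<bar>int i - int j\<bar> \<and> \<bar>int i - int j\<bar> \<le> int n - int d"
  shows "d * card I \<le> n"
proof -
  have "inj_on (\<lambda>(i, r). (i + r) mod n) (I \<times> {..<d})"
  proof (rule inj_onI, clarify)
    fix i r j r' assume I: "i \<in> I" "j \<in> I" and r: "r < d" "r' < d"
      and eq: "(i + r) mod n = (j + r') mod n"
    \<comment> \<open>A collision makes \<open>?x\<close> a multiple of \<open>n\<close>. For
      \<open>i \<noteq> j\<close> the lower distance bound and \<open>\<bar>r - r'\<bar> < d\<close>
      force \<open>?x\<close> to be nonzero, while the upper one gives
      \<open>\<bar>?x\<bar> < n\<close>.\<close>
    let ?x = "(int i - int j) + (int r - int r')"
    have "int n dvd int (i + r) - int (j + r')"
      using arg_cong[OF eq, of int] by (simp only: zmod_int mod_eq_dvd_iff)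
    then have "int n dvd ?x" by (simp add: add_diff_add)
    then have zero: "?x = 0" if "\<bar>?x\<bar> < int n"
      using dvd_imp_le_int[of ?x "int n"] that by linarith
    show "i = j \<and> r = r'"
    proof (cases "i = j")
      case True
      then have "\<bar>?x\<bar> < int n" using r assms(2) by linarith
      from zero[OF this] True show ?thesis by simp
    next
      case False
      from spread[OF I False] have "int d \<le> \<bar>int i - int j\<bar>" "\<bar>int i - int j\<bar> \<le> int n - int d"
        by auto
      then have "\<bar>?x\<bar> < int n" "?x \<noteq> 0" using r by linarith+
      then show ?thesis using zero by blast
    qed
  qed
  moreover have "(\<lambda>(i, r). (i + r) mod n) ` (I \<times> {..<d}) \<subseteq> {..<n}"
    using assms(1) by auto
  ultimately have "card (I \<times> {..<d}) \<le> card {..<n}"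
    by (intro card_inj_on_le) auto
  then show ?thesis by (simp add: card_cartesian_product mult.commute)
qed

lemma cyclic_distance_b_matching_card:
  assumes "bipartite_graph S T E" "s \<in> permutations_of_set S"
    "cyclic_distance_b_matching S T E d b s M" "t \<in> T" "d \<le> card S"
  shows "d * card {y. (y, t) \<in> M} \<le> card S"
proof -
  let ?I = "{i. i < length s \<and> (s ! i, t) \<in> M}"
  have len: "length s = card S" and set: "set s = S"
    using assms(2) by (auto simp: length_finite_permutations_of_set dest: permutations_of_setD)
  have "{y. (y, t) \<in> M} \<subseteq> (!) s ` ?I"
  proof
    fix y assume y: "y \<in> {y. (y, t) \<in> M}"
    then have "y \<in> set s"
      using assms set by (auto simp: cyclic_distance_b_matching_def b_matching_def bipartite_graph_def)
    then show "y \<in> (!) s ` ?I" using y by (auto simp: in_set_conv_nth)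
  qed
  then have "card {y. (y, t) \<in> M} \<le> card ?I"
    by (intro surj_card_le) auto
  moreover have "d * card ?I \<le> length s"
    using assms(3-5) len by (intro cyclic_spread_card) (auto simp: cyclic_distance_b_matching_def)
  ultimately show ?thesis using len mult_le_mono2[of "card {y. (y, t) \<in> M}" "card ?I" d] by linarith
qed

text \<open>The first step of the algorithm is thus a relaxation: every feasible solution, under any
  ordering, competes with the chosen matching.\<close>

lemma b_matching_capped_if_cyclic_distance_b_matching:
  assumes "bipartite_graph S T E" "s \<in> permutations_of_set S"
    "cyclic_distance_b_matching S T E d b s M" "1 \<le> d" "d \<le> card S"
  shows "b_matching S T E (capped S T d b) M"
proof -
  have M: "M \<subseteq> E" "\<And>v. v \<in> S \<union> T \<Longrightarrow> enat (degree M v) \<le> b v"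
    using assms(3) by (auto simp: cyclic_distance_b_matching_def b_matching_def)
  have "degree M t \<le> card S div d" if "t \<in> T" for t
    using cyclic_distance_b_matching_card[OF assms(1-3) that assms(5)] degree_right[OF assms(1) M(1) that]
      assms(4) by (simp add: less_eq_div_iff_mult_less_eq mult.commute)
  then show ?thesis using M by (auto simp: b_matching_def capped_def)
qed

lemma b_matching_capped_card:
  assumes "bipartite_graph S T E" "b_matching S T E (capped S T d b) M" "t \<in> T"
  shows "d * card {y. (y, t) \<in> M} \<le> card S" "card {y. (y, t) \<in> M} \<le> max_cap S T d b"
proof -
  let ?c = "card {y. (y, t) \<in> M}"
  have fin: "finite T" using assms by (simp add: bipartite_graph_def)
  have le: "enat ?c \<le> capped S T d b t"
    using assms(2,3) degree_right[OF assms(1) _ assms(3), of M] by (force simp: b_matching_def)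
  then have "?c \<le> card S div d" using assms(3) by (simp add: capped_def)
  then show "d * ?c \<le> card S"
    using mult_le_mono2[of ?c "card S div d" d] times_div_less_eq_dividend[of d "card S"] by linarith
  let ?m = "Max (capped S T d b ` T)"
  have "?m \<in> capped S T d b ` T" using fin assms(3) by (intro Max_in) auto
  \<comment> \<open>The maximum is finite, so \<open>the_enat\<close> in \<open>max_cap\<close>
    recovers it exactly.\<close>
  then have "?m \<le> enat (card S div d)" by (auto simp: capped_def)
  then obtain m where "?m = enat m" using enat_ile by blast
  moreover have "capped S T d b t \<le> ?m" using fin assms(3) by (intro Max_ge) auto
  ultimately show "?c \<le> max_cap S T d b"
    using order_trans[OF le] unfolding max_cap_def by fastforce
qed

section \<open>Bounding the optimum from both sides\<close>

text \<open>This keeps the set under \<open>Max\<close> in \<open>heaviest_weight\<close>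
  nonempty.\<close>

lemma cyclic_distance_b_matching_empty: "cyclic_distance_b_matching S T E d b s {}"
  by (simp add: cyclic_distance_b_matching_def b_matching_def degree_def flip: zero_enat_def)

lemma finite_cyclic_distance_b_matchings:
  assumes "bipartite_graph S T E"
  shows "finite {M. cyclic_distance_b_matching S T E d b s M}"
proof (rule finite_subset)
  show "{M. cyclic_distance_b_matching S T E d b s M} \<subseteq> Pow (S \<times> T)"
    using assms by (auto simp: cyclic_distance_b_matching_def b_matching_def bipartite_graph_def)
qed (use assms in \<open>auto simp: bipartite_graph_def\<close>)

lemma opt_weight_le:
  assumes "bipartite_graph S T E"
    and "\<And>s M. s \<in> permutations_of_set S \<Longrightarrow> cyclic_distance_b_matching S T E d b s M \<Longrightarrow> weight w M \<le> c"
  shows "opt_weight S T E w d b \<le> c"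
proof -
  have "heaviest_weight S T E w d b s \<le> c" if "s \<in> permutations_of_set S" for s
    unfolding heaviest_weight_def
    using finite_cyclic_distance_b_matchings[OF assms(1), of d b s] assms(2)[OF that]
      cyclic_distance_b_matching_empty[of S T E d b s]
    by (subst Max_le_iff) auto
  then show ?thesis
    unfolding opt_weight_def using assms(1)
    by (subst Max_le_iff) (auto simp: bipartite_graph_def)
qed

lemma opt_weight_ge:
  assumes "bipartite_graph S T E" "s \<in> permutations_of_set S" "cyclic_distance_b_matching S T E d b s M"
  shows "weight w M \<le> opt_weight S T E w d b"
proof -
  have "weight w M \<le> heaviest_weight S T E w d b s"
    unfolding heaviest_weight_def
    using finite_cyclic_distance_b_matchings[OF assms(1)] assms(3) by (intro Max_ge) auto
  also have "\<dots> \<le> opt_weight S T E w d b"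
    unfolding opt_weight_def using assms(2) by (intro Max_ge) auto
  finally show ?thesis .
qed

section \<open>Feasibility of the output\<close>

text \<open>Two positions cut the cycle into two arcs. Along each arc one position is a predecessor
  of the other, so an arc shorter than \<open>d\<close> would have removed one of the two
  edges.\<close>

lemma cyclic_distance_select_edges:
  assumes "i < length s" "i' < length s" "i \<noteq> i'" "distinct s"
    "(s ! i, t) \<in> select_edges T d M s" "(s ! i', t) \<in> select_edges T d M s"
  shows "int d \<le> \<bar>int i - int i'\<bar>" "\<bar>int i - int i'\<bar> \<le> int (length s) - int d"
proof -
  have M: "(s ! i, t) \<in> M" "(s ! i', t) \<in> M"
    using assms(5,6) by (auto simp: select_edges_def)
  have avoid: "(s ! ((l + length s - j) mod length s), t) \<notin> M"
    if "(s ! l, t) \<in> select_edges T d M s" "l < length s" "j \<in> {1..<d}" "j \<le> length s" for l j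
  proof -
    \<comment> \<open>Distinctness of \<open>s\<close> identifies the position hidden in
      \<open>select_edges\<close> with \<open>l\<close>.\<close>
    have "(s ! nat ((int l - int j) mod int (length s)), t) \<notin> M"
      using that assms(4) by (auto simp: select_edges_def nth_eq_iff_index_eq)
    then show ?thesis using cyclic_predecessor_index[of j "length s" l] that(4) by simp
  qed
  have *: "d \<le> l' - l \<and> l' - l + d \<le> length s"
    if "l < l'" "l' < length s" "(s ! l, t) \<in> select_edges T d M s"
      "(s ! l', t) \<in> select_edges T d M s" "(s ! l, t) \<in> M" "(s ! l', t) \<in> M" for l l'
  proof -
    have "(l' + length s - (l' - l)) mod length s = l"
      using that by (simp add: mod_if)
    then have "\<not> l' - l < d"
      using avoid[of l' "l' - l"] that by force
    \<comment> \<open>The arc that wraps around: going back from \<open>l\<close> past the start of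
      the list reaches \<open>l'\<close>.\<close>
    moreover have "(l + length s - (length s - (l' - l))) mod length s = l'"
      using that by (simp add: mod_if)
    then have "\<not> length s - (l' - l) < d"
      using avoid[of l "length s - (l' - l)"] that by force
    ultimately show ?thesis using that(2) by linarith
  qed
  consider "i < i'" | "i' < i" using assms(3) by linarith
  then have "(d \<le> i' - i \<and> i' - i + d \<le> length s \<and> i < i') \<or>
      (d \<le> i - i' \<and> i - i' + d \<le> length s \<and> i' < i)"
    using *[of i i'] *[of i' i] assms M by cases simp_all
  then show "int d \<le> \<bar>int i - int i'\<bar>" "\<bar>int i - int i'\<bar> \<le> int (length s) - int d"
    by linarith+
qed

lemma cyclic_distance_b_matching_select_edges:
  assumes "bipartite_graph S T E" "s \<in> permutations_of_set S" "b_matching S T E (capped S T d b) M"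
  shows "cyclic_distance_b_matching S T E d b s (select_edges T d M s)"
proof -
  have sub: "M \<subseteq> E" and le: "\<And>v. v \<in> S \<union> T \<Longrightarrow> enat (degree M v) \<le> capped S T d b v"
    using assms(3) by (auto simp: b_matching_def)
  have "finite M" using finite_edges[OF assms(1) sub] .
  have "enat (degree (select_edges T d M s) v) \<le> b v" if "v \<in> S \<union> T" for v
  proof -
    have "degree (select_edges T d M s) v \<le> degree M v"
      unfolding degree_def using \<open>finite M\<close> select_edges_subset[of T d M s]
      by (intro card_mono) auto
    then have "enat (degree (select_edges T d M s) v) \<le> enat (degree M v)" by simp
    also note le[OF that]
    also have "capped S T d b v \<le> b v" by (simp add: capped_def)
    finally show ?thesis .
  qed
  moreover have "select_edges T d M s \<subseteq> E"
    using sub select_edges_subset[of T d M s] by (rule order_trans[rotated])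
  moreover have "distinct s" using assms(2) by (rule permutations_of_setD)
  ultimately show ?thesis
    unfolding cyclic_distance_b_matching_def b_matching_def
    using cyclic_distance_select_edges[of _ s _ _ T d M] by blast
qed

section \<open>The approximation guarantee\<close>

lemma ratio_bound_nonneg: "1 \<le> d \<Longrightarrow> 0 \<le> ratio_bound d k"
  by (simp add: ratio_bound_def le_max_iff_disj)

text \<open>The relaxation bounds the optimum by the weight of \<open>M\<close>, and every edge of
  \<open>M\<close> survives with probability at least the ratio.\<close>

lemma expected_weight_ge:
  assumes G: "bipartite_graph S T E" and w: "\<forall>e\<in>E. 0 \<le> w e" and d: "1 \<le> d" "d \<le> card S"
    and M: "max_weight_b_matching S T E w (capped S T d b) M"
  shows "ratio_bound d (max_cap S T d b) * opt_weight S T E w d b \<le> expected_weight S T w d M"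
proof -
  let ?r = "ratio_bound d (max_cap S T d b)"
  have bM: "b_matching S T E (capped S T d b) M" and sub: "M \<subseteq> E"
    using M by (auto simp: max_weight_b_matching_def b_matching_def)
  have fin: "finite S" using G by (simp add: bipartite_graph_def)
  have "opt_weight S T E w d b \<le> weight w M"
  proof (rule opt_weight_le[OF G])
    fix s N assume "s \<in> permutations_of_set S" "cyclic_distance_b_matching S T E d b s N"
    then have "b_matching S T E (capped S T d b) N"
      using d by (intro b_matching_capped_if_cyclic_distance_b_matching[OF G])
    then show "weight w N \<le> weight w M" using M by (simp add: max_weight_b_matching_def)
  qed
  then have "?r * opt_weight S T E w d b \<le> ?r * weight w M"
    using ratio_bound_nonneg[OF d(1)] by (rule mult_left_mono)
  also have "\<dots> = (\<Sum>(x, t)\<in>M. w (x, t) * ?r)"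
    by (subst mult.commute) (simp add: weight_def sum_distrib_right case_prod_unfold)
  also have "\<dots> \<le> (\<Sum>(x, t)\<in>M. w (x, t) * avoid_prob (card S) (card {y. (y, t) \<in> M}) d)"
  proof (rule sum_mono, clarify)
    fix x t assume e: "(x, t) \<in> M"
    let ?A = "{y. (y, t) \<in> M}"
    have t: "t \<in> T" and A: "?A \<subseteq> S" using e sub G by (auto simp: bipartite_graph_def)
    then have "1 \<le> card ?A"
      using e fin by (auto simp: Suc_le_eq card_gt_0_iff intro: finite_subset)
    then have "?r \<le> avoid_prob (card S) (card ?A) d"
      using b_matching_capped_card[OF G bM t] d by (intro ratio_bound_le_avoid_prob)
    then show "w (x, t) * ?r \<le> w (x, t) * avoid_prob (card S) (card ?A) d"
      using w sub e by (intro mult_left_mono) auto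
  qed
  also have "\<dots> = expected_weight S T w d M"
    using b_matching_capped_card(1)[OF G bM] by (rule expected_weight_eq[OF G sub d(1), symmetric])
  finally show ?thesis .
qed

section \<open>Instances for tightness\<close>

text \<open>One right vertex is joined to \<open>k\<close> equally spaced left vertices, so the identity ordering keeps every
  edge and the full edge set is the only maximum-weight matching.\<close>

lemma bad_instance_if_avoid_prob_less:
  assumes d: "1 \<le> d" and k: "1 \<le> k" and c: "avoid_prob (d * k) k d < c"
  shows "bad_instance d k c"
proof -
  define S T E where "S = {..<d * k}" and "T = {d * k}" and "E = (\<lambda>i. (d * i, d * k)) ` {..<k}"
  define w :: "nat \<times> nat \<Rightarrow> real" where "w = (\<lambda>_. 1)"
  define b :: "nat \<Rightarrow> enat" where "b = (\<lambda>_. \<infinity>)"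
  have G: "bipartite_graph S T E"
    using d by (auto simp: bipartite_graph_def S_def T_def E_def)
  have card_S: "card S = d * k" by (simp add: S_def)
  have cap: "capped S T d b v = (if v \<in> T then enat k else \<infinity>)" for v
    using d by (simp add: capped_def card_S b_def)
  have fin_E: "finite E" and card_E: "card E = k"
    using d by (auto simp: E_def card_image inj_on_def)
  have nbrs: "card {y. (y, t) \<in> E} = k" if "t \<in> T" for t
  proof -
    have "{y. (y, t) \<in> E} = (\<lambda>i. d * i) ` {..<k}" using that by (auto simp: E_def T_def)
    then show ?thesis using d by (simp add: card_image inj_on_def)
  qed
  have "max_cap S T d b = k" by (simp add: max_cap_def cap) (simp add: T_def)
  moreover have "real k \<le> opt_weight S T E w d b"
  proof -
    have "cyclic_distance_b_matching S T E d b [0..<d * k] E"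
    proof -
      \<comment> \<open>The distance is \<open>d * \<bar>i - j\<bar>\<close> with
        \<open>1 \<le> \<bar>i - j\<bar> \<le> k - 1\<close>.\<close>
      have "int d \<le> \<bar>int (d * i) - int (d * j)\<bar> \<and> \<bar>int (d * i) - int (d * j)\<bar> \<le> int (d * k) - int d"
        if "i < k" "j < k" "d * i \<noteq> d * j" for i j
      proof -
        have "\<bar>int (d * i) - int (d * j)\<bar> = int d * \<bar>int i - int j\<bar>"
          by (simp add: abs_mult flip: right_diff_distrib)
        moreover have "int d * 1 \<le> int d * \<bar>int i - int j\<bar>"
          using that by (intro mult_left_mono) auto
        moreover have "int d * \<bar>int i - int j\<bar> \<le> int d * (int k - 1)"
          using that by (intro mult_left_mono) auto
        ultimately show ?thesis by (simp add: right_diff_distrib)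
      qed
      then show ?thesis
        by (auto simp: cyclic_distance_b_matching_def b_matching_def b_def E_def)
    qed
    moreover have "[0..<d * k] \<in> permutations_of_set S"
      by (auto simp: permutations_of_set_def S_def)
    ultimately have "weight w E \<le> opt_weight S T E w d b"
      using opt_weight_ge[OF G] by blast
    then show ?thesis by (simp add: weight_def w_def card_E)
  qed
  moreover have "expected_weight S T w d M < c * opt_weight S T E w d b"
    if M: "max_weight_b_matching S T E w (capped S T d b) M" for M
  proof -
    \<comment> \<open>\<open>E\<close> meets the caps, and with unit weights a matching at least as
      heavy as \<open>E\<close> must be all of \<open>E\<close>.\<close>
    have "b_matching S T E (capped S T d b) E"
      using nbrs degree_right[OF G order_refl] by (auto simp: b_matching_def cap)
    then have "weight w E \<le> weight w M" "M \<subseteq> E"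
      using M by (auto simp: max_weight_b_matching_def b_matching_def)
    then have "M = E" using fin_E by (intro card_seteq) (auto simp: weight_def w_def)
    moreover have "expected_weight S T w d E = (\<Sum>e\<in>E. avoid_prob (d * k) k d)"
    proof -
      have "snd e \<in> T" if "e \<in> E" for e using that by (auto simp: E_def T_def)
      then show ?thesis
        using expected_weight_eq[OF G order_refl d, of w] nbrs
        by (simp add: card_S w_def case_prod_unfold)
    qed
    ultimately have "expected_weight S T w d M = avoid_prob (d * k) k d * real k"
      by (simp add: card_E)
    also have "\<dots> < c * real k" using c k by simp
    \<comment> \<open>Only a lower bound \<open>k\<close> on the optimum is known, so
      \<open>c\<close> must be nonnegative; it exceeds a nonnegative probability.\<close>
    also have "0 \<le> (1 - 1 / real d) ^ (d - 1)" using d by simp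
    then have "0 \<le> avoid_prob (d * k) k d"
      using avoid_prob_ge[of k d "d * k"] d k by linarith
    then have "c * real k \<le> c * opt_weight S T E w d b"
      using \<open>real k \<le> opt_weight S T E w d b\<close> c by (intro mult_left_mono) auto
    finally show ?thesis .
  qed
  ultimately have "bipartite_graph S T E \<and> (\<forall>e\<in>E. 0 \<le> w e) \<and> T \<noteq> {} \<and> d \<le> card S \<and>
      max_cap S T d b = k \<and> 0 < opt_weight S T E w d b \<and>
      (\<forall>M. max_weight_b_matching S T E w (capped S T d b) M \<longrightarrow>
         expected_weight S T w d M < c * opt_weight S T E w d b)"
    using G k by (simp add: card_S w_def T_def)
  then show ?thesis unfolding bad_instance_def by blast
qed

section \<open>Guarantee and tightness combined\<close>

text \<open>Tightness takes the form of two limits: for fixed \<open>d\<close> the ratio on the bad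
  instances approaches the first entry of the maximum as \<open>k\<close> grows, and for fixed
  \<open>k\<close> the second as \<open>d\<close> grows.\<close>

theorem theorem11:
  shows "(\<forall>(S :: 'v set) T E (w :: 'v \<times> 'v \<Rightarrow> real) (d :: nat) (b :: 'v \<Rightarrow> enat) Mhat.
            bipartite_graph S T E \<and> (\<forall>e\<in>E. 0 \<le> w e) \<and> 1 \<le> d \<and>
            max_weight_b_matching S T E w (capped S T d b) Mhat \<longrightarrow>
              (\<forall>(s, M) \<in> set_pmf (algorithm_output S T d Mhat).
                 cyclic_distance_b_matching S T E d b s M) \<and>
              (d \<le> card S \<longrightarrow>
                 ratio_bound d (max_cap S T d b) * opt_weight S T E w d b
                   \<le> expected_weight S T w d Mhat))
       \<and> (\<forall>d\<ge>1. \<forall>\<epsilon>>0. \<forall>\<^sub>F k in at_top. bad_instance d k (ratio_bound d k + \<epsilon>))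
       \<and> (\<forall>k\<ge>1. \<forall>\<epsilon>>0. \<forall>\<^sub>F d in at_top. bad_instance d k (ratio_bound d k + \<epsilon>))"
proof (intro conjI allI impI)
  fix S T E and w :: "'v \<times> 'v \<Rightarrow> real" and d :: nat and b :: "'v \<Rightarrow> enat" and Mhat
  assume *: "bipartite_graph S T E \<and> (\<forall>e\<in>E. 0 \<le> w e) \<and> 1 \<le> d \<and>
    max_weight_b_matching S T E w (capped S T d b) Mhat"
  then have "finite S" by (simp add: bipartite_graph_def)
  then have "set_pmf (algorithm_output S T d Mhat)
      = (\<lambda>s. (s, select_edges T d Mhat s)) ` permutations_of_set S"
    by (simp add: algorithm_output_def)
  then show "\<forall>(s, M) \<in> set_pmf (algorithm_output S T d Mhat). cyclic_distance_b_matching S T E d b s M"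
    using * cyclic_distance_b_matching_select_edges[of S T E _ d b Mhat]
    by (auto simp: max_weight_b_matching_def)
  assume "d \<le> card S"
  then show "ratio_bound d (max_cap S T d b) * opt_weight S T E w d b \<le> expected_weight S T w d Mhat"
    using * by (intro expected_weight_ge) auto
next
  fix d :: nat and \<epsilon> :: real assume "1 \<le> d" "0 < \<epsilon>"
  then have "\<forall>\<^sub>F k in at_top. avoid_prob (d * k) k d < (1 - 1 / real d) ^ (d - 1) + \<epsilon>"
    by (intro order_tendstoD(2)[OF avoid_prob_tendsto]) auto
  with eventually_ge_at_top[of 1] show "\<forall>\<^sub>F k in at_top. bad_instance d k (ratio_bound d k + \<epsilon>)"
  proof eventually_elim
    case (elim k)
    then show ?case using \<open>1 \<le> d\<close>
      by (intro bad_instance_if_avoid_prob_less) (auto simp: ratio_bound_def)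
  qed
next
  fix k :: nat and \<epsilon> :: real assume k: "1 \<le> k" "0 < \<epsilon>"
  \<comment> \<open>The limit is used with \<open>d\<close> and \<open>k\<close> exchanged; the
    symmetry of \<open>avoid_prob\<close> undoes the exchange below.\<close>
  then have "\<forall>\<^sub>F d in at_top. avoid_prob (k * d) d k < (1 - 1 / real k) ^ (k - 1) + \<epsilon>"
    by (intro order_tendstoD(2)[OF avoid_prob_tendsto]) auto
  with eventually_ge_at_top[of 1] show "\<forall>\<^sub>F d in at_top. bad_instance d k (ratio_bound d k + \<epsilon>)"
  proof eventually_elim
    case (elim d)
    have "avoid_prob (d * k) k d = avoid_prob (k * d) d k"
      using elim k avoid_prob_commute[of k d "d * k"] add_le_Suc_if_mult_le[of k d "d * k"]
      by (simp add: mult.commute)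
    then show ?case using elim k
      by (intro bad_instance_if_avoid_prob_less) (auto simp: ratio_bound_def)
  qed
qed

end
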